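(* Let $s\in\mathbb{N}\cup\{\infty\}$, let $l$ be an integer with $1\le l\le s-1$ (any $l\geq 1$ if $s=\infty$), and let $H(x)=x^{l+1}+\sum_{i=l+2}^s h_ix^i\in\boldsymbol{k}[[x]]_s$. Let $T\in\Gamma^s_1$ transform $(\mathrm{AJ}_s(H))$ to $(\mathrm{AJ}_s(\widetilde H))$, where $\widetilde H(x)=x^{l+1}+\delta x^{2l+1}$, $\delta\in\boldsymbol{k}$, and $\delta=0$ if $s\le 2l$. Then: (i) $\mathcal{A}_T(\mathcal{S}(\mathrm{AJ}_s(H)))=\mathcal{S}(\mathrm{AJ}_s(\widetilde H))$, and $\mathcal{S}(\mathrm{AJ}_s(\widetilde H))$ is the (internal) semidirect product of its subgroup $\mathcal{L}_l$ and its normal subgroup $\mathcal{S}_1(\mathrm{AJ}_s(\widetilde H))$; (ii) $\mathcal{S}(\mathrm{AJ}_s(H))=\mathcal{A}_{T^{-1}}(\mathcal{S}(\mathrm{AJ}_s(\widetilde H)))=\{T\circ(L_c\circ\Phi)\circ T^{-1}: c\in\boldsymbol{E}_l,\ \Phi\in\mathcal{S}_1(\mathrm{AJ}_s(\widetilde H))\}$.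
   Context: $\boldsymbol{k}$ is a field of characteristic $0$. $\boldsymbol{k}[[x]]_\infty:=\boldsymbol{k}[[x]]$; for $s\in\mathbb{N}$, $\boldsymbol{k}[[x]]_s=\boldsymbol{k}[[x]]/(x^{s+1})$, with elements identified with polynomials $\sum_{j=0}^s c_jx^j$ and operations (including substitution) computed modulo $x^{s+1}$. $\Gamma^s$ is the group (under substitution $\circ$, identity $x$) of $f\in\boldsymbol{k}[[x]]_s$ of order exactly $1$, and $\Gamma^s_1=\{f\in\Gamma^s: f(x)\equiv x \bmod x^2\}$. Inverses $T^{-1}$ are with respect to substitution. $\boldsymbol{E}_l=\{c\in\boldsymbol{k}:c^l=1\}$, $L_c(x)=cx$, $\mathcal{L}_l=\{L_c:c\in\boldsymbol{E}_l\}$. For $H\in\boldsymbol{k}[[x]]_s$ of order $\ge1$, $(\mathrm{AJ}_s(H))$ is the equation $(H\circ\Phi)(x)=\frac{d\Phi}{dx}\cdot H(x)$ (mod $x^{s+1}$ if $s<\infty$), $\mathcal{S}(\mathrm{AJ}_s(H))$ is the set of its solutions $\Phi\in\Gamma^s$ (a group under substitution), and $\mathcal{S}_1(\mathrm{AJ}_s(H))=\mathcal{S}(\mathrm{AJ}_s(H))\cap\Gamma^s_1$. We say that $T\in\Gamma^s_1$ transforms $(\mathrm{AJ}_s(H))$ to $(\mathrm{AJ}_s(\widetilde H))$ if $\widetilde H(x)=\left(\frac{dT}{dx}\right)^{-1}(H\circ T)(x)$ (multiplicative inverse of $dT/dx$; mod $x^{s+1}$ if $s<\infty$). $\mathcal{A}_T:\Gamma^s\to\Gamma^s$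 is the inner automorphism $\mathcal{A}_T(F)=T^{-1}\circ F\circ T$. A group $G$ is the semidirect product of a subgroup $H_1$ and a normal subgroup $H_2$ if $G=H_1H_2$ and $H_1\cap H_2$ is trivial. *)

theory Defs
  imports
    "HOL-Algebra.Coset"
    "HOL-Computational_Algebra.Formal_Power_Series"
    "HOL-Library.Extended_Nat"
begin

unbundle fps_syntax

text \<open>
  The truncated ring \<open>k[[x]]\<^sub>s = k[[x]] / (x\<^sup>s\<^sup>+\<^sup>1)\<close>, for \<open>s\<close> a natural number or \<open>\<infinity>\<close>, is
  represented by the canonical representatives of its classes, namely the power series whose
  coefficients of index greater than \<open>s\<close> vanish (all power series if \<open>s = \<infinity>\<close>). Operations are
  performed in \<open>k[[x]]\<close> and then reduced by \<open>fps_red s\<close>.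
\<close>

definition fps_red :: "enat \<Rightarrow> 'a::zero fps \<Rightarrow> 'a fps" where
  "fps_red s f = (case s of enat m \<Rightarrow> fps_cutoff (Suc m) f | \<infinity> \<Rightarrow> f)"

definition trunc_fps :: "enat \<Rightarrow> 'a::zero fps set" where
  "trunc_fps s = {f. \<forall>n. s < enat n \<longrightarrow> f $ n = 0}"

text \<open>
  \<open>fps_X\<close> lies in the carrier exactly when \<open>s \<ge> 1\<close>; the case \<open>s = 0\<close> is degenerate
  (there is no element of order 1) and is not a group.
\<close>

definition subst_group :: "enat \<Rightarrow> 'a::field fps monoid" where
  "subst_group s =
     \<lparr>carrier = {f \<in> trunc_fps s. subdegree f = 1},
      monoid.mult = (\<lambda>f g. fps_red s (f oo g)),
      monoid.one = fps_X\<rparr>"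

definition subst_group1 :: "enat \<Rightarrow> 'a::field fps set" where
  "subst_group1 s = {f \<in> carrier (subst_group s). f $ 1 = 1}"

definition roots_of_1 :: "nat \<Rightarrow> 'a::field set" where
  "roots_of_1 l = {c. c ^ l = 1}"

definition lin_fps :: "'a::field \<Rightarrow> 'a fps" where
  "lin_fps c = fps_const c * fps_X"

definition lin_group :: "nat \<Rightarrow> 'a::field fps set" where
  "lin_group l = lin_fps ` roots_of_1 l"

text \<open>
  Below, \<open>fps_deriv f\<close> is determined by the class of \<open>f\<close> only modulo \<open>x\<^sup>s\<close>; the products are
  nevertheless well defined modulo \<open>x\<^sup>s\<^sup>+\<^sup>1\<close>, because the other factor has order at least 1
  whenever \<open>H\<close> has.
\<close>

definition AJ :: "enat \<Rightarrow> 'a::field fps \<Rightarrow> 'a fps \<Rightarrow> bool" where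
  "AJ s H \<Phi> \<longleftrightarrow> fps_red s (H oo \<Phi>) = fps_red s (fps_deriv \<Phi> * H)"

definition AJ_sols :: "enat \<Rightarrow> 'a::field fps \<Rightarrow> 'a fps set" where
  "AJ_sols s H = {\<Phi> \<in> carrier (subst_group s). AJ s H \<Phi>}"

definition AJ_sols1 :: "enat \<Rightarrow> 'a::field fps \<Rightarrow> 'a fps set" where
  "AJ_sols1 s H = AJ_sols s H \<inter> subst_group1 s"

definition AJ_transforms :: "enat \<Rightarrow> 'a::field fps \<Rightarrow> 'a fps \<Rightarrow> 'a fps \<Rightarrow> bool" where
  "AJ_transforms s T H H' \<longleftrightarrow>
     T \<in> subst_group1 s \<and> H' = fps_red s (inverse (fps_deriv T) * (H oo T))"

definition inner_aut :: "('a, 'b) monoid_scheme \<Rightarrow> 'a \<Rightarrow> 'a \<Rightarrow> 'a" where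
  "inner_aut G t f = inv\<^bsub>G\<^esub> t \<otimes>\<^bsub>G\<^esub> f \<otimes>\<^bsub>G\<^esub> t"

definition internal_semidirect ::
    "('a, 'b) monoid_scheme \<Rightarrow> 'a set \<Rightarrow> 'a set \<Rightarrow> bool" where
  "internal_semidirect G K N \<longleftrightarrow>
     group G \<and> subgroup K G \<and> N \<lhd> G \<and>
     carrier G = K <#>\<^bsub>G\<^esub> N \<and> K \<inter> N = {\<one>\<^bsub>G\<^esub>}"

end

theory Submission
  imports Defs
begin

text \<open>
  Think of a series \<open>H\<close> as the formal vector field \<open>H d/dx\<close>. A substitution \<open>\<Phi>\<close> pulls it back
  to the field with coefficient \<open>(H oo \<Phi>) / \<Phi>'\<close>, and by the chain rule this is a right action
  of the substitution group on the series without constant term (\<open>pullback_mult\<close>). Truncation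
  is harmless: the derivative is known only to one order less, but it is always multiplied by a
  series without constant term (\<open>pullback_fps_red\<close>).

  In these terms the Aczel--Jabotinsky equation for \<open>H\<close> says that \<open>\<Phi>\<close> fixes \<open>H\<close>, so its
  solutions form the stabilizer of \<open>H\<close> (\<open>AJ_sols_eq_stabilizer\<close>), and a
  transformation \<open>T\<close> of the equation of \<open>H\<close> to that of \<open>H'\<close> carries \<open>H\<close> to \<open>H'\<close>. Stabilizers
  of points in one orbit are conjugate, which gives the statements on \<open>inner_aut\<close>
  (\<open>inner_aut_image_AJ_sols\<close>).

  For the semidirect product, consider the homomorphism that takes a substitution to its linear
  coefficient \<open>c\<close>. Since \<open>H'\<close> has order \<open>l + 1\<close>, comparing coefficients at \<open>x ^ (l + 1)\<close> shows
  \<open>c ^ l = 1\<close> for solutions (\<open>AJ_sols_nth_1\<close>). Conversely, the exponents of the normal form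
  \<open>H'\<close> are congruent to \<open>1\<close> modulo \<open>l\<close>, so every \<open>x \<mapsto> c x\<close> with \<open>c ^ l = 1\<close> is itself a solution
  (\<open>lin_group_subset_AJ_sols\<close>). Hence the homomorphism maps onto the \<open>l\<close>-th roots of unity and
  is split by the linear substitutions; its kernel is the group of solutions tangent to the
  identity (\<open>internal_semidirect_lin_group\<close>).
\<close>

section \<open>Reduction modulo a power of the variable\<close>

lemma fps_red_nth [simp]: "fps_red s f $ n = (if enat n \<le> s then f $ n else 0)"
  by (cases s) (auto simp: fps_red_def)

lemma fps_red_eq_iff: "fps_red s f = fps_red s g \<longleftrightarrow> (\<forall>n. enat n \<le> s \<longrightarrow> f $ n = g $ n)"
  by (auto simp: fps_eq_iff)

lemma fps_red_idem [simp]: "fps_red s (fps_red s f) = fps_red s f"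
  by (simp add: fps_red_eq_iff)

lemma fps_red_in_trunc [simp]: "fps_red s f \<in> trunc_fps s"
  by (auto simp: trunc_fps_def)

lemma fps_red_trunc: "f \<in> trunc_fps s \<Longrightarrow> fps_red s f = f"
  by (auto simp: trunc_fps_def fps_eq_iff not_le)

lemma fps_red_mult_cong:
  fixes a b c d :: "'a::semiring_0 fps"
  assumes "fps_red s a = fps_red s b" and "fps_red s c = fps_red s d"
  shows "fps_red s (a * c) = fps_red s (b * d)"
  unfolding fps_red_eq_iff
proof (intro allI impI)
  fix n assume n: "enat n \<le> s"
  have "a $ i = b $ i" "c $ i = d $ i" if "i \<le> n" for i
    using assms n that order.trans[of "enat i" "enat n" s]
    unfolding fps_red_eq_iff by auto
  then show "(a * c) $ n = (b * d) $ n"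
    by (simp add: fps_mult_nth)
qed

lemma fps_red_power_cong:
  fixes a b :: "'a::semiring_1 fps"
  shows "fps_red s a = fps_red s b \<Longrightarrow> fps_red s (a ^ k) = fps_red s (b ^ k)"
  by (induction k) (auto intro: fps_red_mult_cong)

lemma fps_red_compose_cong:
  fixes a b c d :: "'a::semiring_1 fps"
  assumes "fps_red s a = fps_red s b" and "fps_red s c = fps_red s d"
  shows "fps_red s (a oo c) = fps_red s (b oo d)"
  unfolding fps_red_eq_iff
proof (intro allI impI)
  fix n assume n: "enat n \<le> s"
  have "a $ i = b $ i" if "i \<le> n" for i
    using assms(1) n that order.trans[of "enat i" "enat n" s]
    unfolding fps_red_eq_iff by auto
  moreover have "c ^ i $ n = d ^ i $ n" for i
    using fps_red_power_cong[OF assms(2), of i] n unfolding fps_red_eq_iff by blast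
  ultimately show "(a oo c) $ n = (b oo d) $ n"
    by (simp add: fps_compose_nth)
qed

text \<open>
  Differentiation loses one order of precision: \<open>f' $ s\<close> involves the coefficient of
  \<open>f\<close> at \<open>s + 1\<close>. A factor without constant term makes up for this.
\<close>

lemma fps_red_deriv_mult_cong:
  fixes f g H :: "'a::semiring_1 fps"
  assumes "fps_red s f = fps_red s g" and "H $ 0 = 0"
  shows "fps_red s (fps_deriv f * H) = fps_red s (fps_deriv g * H)"
  unfolding fps_red_eq_iff
proof (intro allI impI)
  fix n assume n: "enat n \<le> s"
  have "fps_deriv f $ i * H $ (n - i) = fps_deriv g $ i * H $ (n - i)" if "i \<le> n" for i
  proof (cases "i = n")
    case False
    then have "f $ Suc i = g $ Suc i"
      using assms(1) n that order.trans[of "enat (Suc i)" "enat n" s]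
      unfolding fps_red_eq_iff by auto
    then show ?thesis by simp
  qed (simp add: assms(2))
  then show "(fps_deriv f * H) $ n = (fps_deriv g * H) $ n"
    by (simp add: fps_mult_nth)
qed

lemma fps_red_inverse_mult_cong:
  fixes a b H :: "'a::field fps"
  assumes ab: "fps_red s (a * H) = fps_red s (b * H)" and "a $ 0 \<noteq> 0" and "b $ 0 \<noteq> 0"
  shows "fps_red s (inverse a * H) = fps_red s (inverse b * H)"
proof -
  have "(inverse a * inverse b) * (b * H) = inverse a * H * (inverse b * b)"
    "(inverse a * inverse b) * (a * H) = inverse b * H * (inverse a * a)"
    by (simp_all only: mult_ac)
  then have "(inverse a * inverse b) * (b * H) = inverse a * H"
    "(inverse a * inverse b) * (a * H) = inverse b * H"
    using inverse_mult_eq_1[OF assms(2)] inverse_mult_eq_1[OF assms(3)] by simp_all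
  then show ?thesis
    using fps_red_mult_cong[OF refl ab, of "inverse a * inverse b"] by (simp only:)
qed

section \<open>The substitution group\<close>

lemma carrier_subst_group_iff:
  "f \<in> carrier (subst_group s) \<longleftrightarrow> f \<in> trunc_fps s \<and> f $ 0 = 0 \<and> f $ 1 \<noteq> 0"
proof -
  have "subdegree f = 1 \<longleftrightarrow> f $ 0 = 0 \<and> f $ 1 \<noteq> 0"
    by (metis One_nat_def less_one nth_less_subdegree_zero nth_subdegree_nonzero
        subdegreeI subdegree_0 zero_neq_one)
  then show ?thesis
    by (auto simp: subst_group_def)
qed

lemma subst_group_mult: "f \<otimes>\<^bsub>subst_group s\<^esub> g = fps_red s (f oo g)"
  by (simp add: subst_group_def)

lemma subst_group_one: "\<one>\<^bsub>subst_group s\<^esub> = fps_X"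
  by (simp add: subst_group_def)

lemma compose_nth_1:
  fixes f g :: "'a::idom fps"
  shows "g $ 0 = 0 \<Longrightarrow> (f oo g) $ 1 = f $ 1 * g $ 1"
  by (simp add: fps_compose_nth)

lemma subst_group_mult_nth_1:
  assumes "1 \<le> s" and "g \<in> carrier (subst_group s)"
  shows "(f \<otimes>\<^bsub>subst_group s\<^esub> g) $ 1 = f $ 1 * g $ 1"
  using assms compose_nth_1[of g f] one_enat_def
  by (auto simp: subst_group_mult carrier_subst_group_iff)

text \<open>Inverses are obtained by truncating the compositional inverse in the full ring.\<close>

lemma group_subst_group:
  assumes s: "1 \<le> s"
  shows "group (subst_group s :: 'a::field fps monoid)"
proof (rule groupI)
  have s1: "enat 1 \<le> s" "enat (Suc 0) \<le> s"
    using s by (simp_all add: one_enat_def)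
  fix f g h :: "'a fps"
  assume f: "f \<in> carrier (subst_group s)"
  then have f0: "f $ 0 = 0" "f $ 1 \<noteq> 0"
    by (auto simp: carrier_subst_group_iff)
  have "fps_X oo f = f"
    using f0 by simp
  then show "\<one>\<^bsub>subst_group s\<^esub> \<otimes>\<^bsub>subst_group s\<^esub> f = f"
    using f by (simp add: subst_group_mult subst_group_one carrier_subst_group_iff fps_red_trunc)
  let ?i = "fps_red s (fps_inv f)"
  have "fps_inv f $ 1 * f $ 1 = 1"
    using compose_nth_1[OF f0(1), of "fps_inv f"] fps_inv[OF f0] by simp
  then have "?i \<in> carrier (subst_group s)"
    using s1 by (auto simp: carrier_subst_group_iff fps_inv_def)
  moreover have "?i \<otimes>\<^bsub>subst_group s\<^esub> f = \<one>\<^bsub>subst_group s\<^esub>"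
  proof -
    have "fps_red s (?i oo f) = fps_red s (fps_inv f oo f)"
      by (rule fps_red_compose_cong) simp_all
    also have "\<dots> = fps_X"
      using fps_inv[OF f0] s1 by (auto simp: fps_eq_iff fps_X_def)
    finally show ?thesis by (simp add: subst_group_mult subst_group_one)
  qed
  ultimately show "\<exists>y\<in>carrier (subst_group s). y \<otimes>\<^bsub>subst_group s\<^esub> f = \<one>\<^bsub>subst_group s\<^esub>"
    by blast
  assume g: "g \<in> carrier (subst_group s)"
  then have g0: "g $ 0 = 0" "g $ 1 \<noteq> 0"
    by (auto simp: carrier_subst_group_iff)
  show "f \<otimes>\<^bsub>subst_group s\<^esub> g \<in> carrier (subst_group s)"
    using f0 g0 s1 compose_nth_1[OF g0(1), of f]
    by (simp add: subst_group_mult carrier_subst_group_iff)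
  assume h: "h \<in> carrier (subst_group s)"
  then have h0: "h $ 0 = 0"
    by (auto simp: carrier_subst_group_iff)
  have "fps_red s (fps_red s (f oo g) oo h) = fps_red s ((f oo g) oo h)"
    by (rule fps_red_compose_cong) simp_all
  also have "\<dots> = fps_red s (f oo (g oo h))"
    using fps_compose_assoc[OF h0 g0(1)] by simp
  also have "\<dots> = fps_red s (f oo fps_red s (g oo h))"
    by (rule fps_red_compose_cong) simp_all
  finally show "f \<otimes>\<^bsub>subst_group s\<^esub> g \<otimes>\<^bsub>subst_group s\<^esub> h
      = f \<otimes>\<^bsub>subst_group s\<^esub> (g \<otimes>\<^bsub>subst_group s\<^esub> h)"
    by (simp add: subst_group_mult)
next
  show "\<one>\<^bsub>subst_group s\<^esub> \<in> carrier (subst_group s :: 'a fps monoid)"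
    using s one_enat_def
    by (auto simp: subst_group_one carrier_subst_group_iff trunc_fps_def)
qed

section \<open>Pulling back a vector field\<close>

text \<open>
  The pullback of the formal vector field \<open>H d/dx\<close> along the substitution \<open>\<Phi>\<close>, truncated at
  order \<open>s\<close>.
\<close>

definition pullback :: "enat \<Rightarrow> 'a::field fps \<Rightarrow> 'a fps \<Rightarrow> 'a fps" where
  "pullback s H \<Phi> = fps_red s (inverse (fps_deriv \<Phi>) * (H oo \<Phi>))"

lemma pullback_nth_0: "H $ 0 = 0 \<Longrightarrow> pullback s H \<Phi> $ 0 = 0"
  by (simp add: pullback_def)

lemma pullback_one: "pullback s H fps_X = fps_red s H"
  by (simp add: pullback_def)

text \<open>Although a derivative occurs in it, the pullback depends on the substitution only
  up to order \<open>s\<close>, because \<open>H oo \<Phi>\<close> has no constant term.\<close>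

lemma pullback_fps_red:
  assumes "1 \<le> s" and "H $ 0 = 0" and "F $ 1 \<noteq> 0"
  shows "pullback s H (fps_red s F) = pullback s H F"
proof -
  have "fps_red s (inverse (fps_deriv (fps_red s F)) * (H oo fps_red s F))
      = fps_red s (inverse (fps_deriv (fps_red s F)) * (H oo F))"
    by (intro fps_red_mult_cong fps_red_compose_cong) simp_all
  also have "\<dots> = fps_red s (inverse (fps_deriv F) * (H oo F))"
    using assms one_enat_def
    by (intro fps_red_inverse_mult_cong fps_red_deriv_mult_cong) auto
  finally show ?thesis
    by (simp add: pullback_def)
qed

text \<open>The chain rule makes the pullback a right action of the substitution group.\<close>

lemma pullback_mult:
  assumes s: "1 \<le> s" and H: "H $ 0 = 0"
    and "F \<in> carrier (subst_group s)" and "E \<in> carrier (subst_group s)"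
  shows "pullback s H (F \<otimes>\<^bsub>subst_group s\<^esub> E) = pullback s (pullback s H F) E"
proof -
  have F: "F $ 0 = 0" "F $ 1 \<noteq> 0" and E: "E $ 0 = 0" "E $ 1 \<noteq> 0"
    using assms by (auto simp: carrier_subst_group_iff)
  have "(F oo E) $ 1 \<noteq> 0"
    using compose_nth_1[OF E(1), of F] F(2) E(2) by simp
  then have "pullback s H (F \<otimes>\<^bsub>subst_group s\<^esub> E) = pullback s H (F oo E)"
    by (simp add: subst_group_mult pullback_fps_red[OF s H])
  also have "\<dots> = fps_red s (inverse ((fps_deriv F oo E) * fps_deriv E) * (H oo (F oo E)))"
    by (simp add: pullback_def fps_compose_deriv[OF E(1)])
  also have "inverse ((fps_deriv F oo E) * fps_deriv E) * (H oo (F oo E))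
      = inverse (fps_deriv E) * ((inverse (fps_deriv F) * (H oo F)) oo E)"
    using F E
    by (simp add: fps_inverse_mult fps_compose_mult_distrib fps_inverse_compose
        fps_compose_assoc mult_ac)
  also have "fps_red s \<dots>
      = fps_red s (inverse (fps_deriv E) * (fps_red s (inverse (fps_deriv F) * (H oo F)) oo E))"
    by (intro fps_red_mult_cong fps_red_compose_cong) simp_all
  finally show ?thesis
    by (simp add: pullback_def)
qed

text \<open>The Aczel--Jabotinsky equation says precisely that \<open>\<Phi>\<close> preserves the vector field.\<close>

lemma AJ_iff_pullback:
  assumes "\<Phi> $ 1 \<noteq> 0"
  shows "AJ s H \<Phi> \<longleftrightarrow> pullback s H \<Phi> = fps_red s H"
proof -
  let ?D = "fps_deriv \<Phi>"
  have D: "inverse ?D * ?D = 1"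
    using assms by (intro inverse_mult_eq_1) simp
  have D': "?D * (inverse ?D * K) = K" "inverse ?D * (?D * K) = K" for K
    using D by (simp_all add: mult.assoc[symmetric] mult.commute[of ?D])
  show ?thesis
    using fps_red_mult_cong[of s ?D ?D "inverse ?D * (H oo \<Phi>)" H]
      fps_red_mult_cong[of s "inverse ?D" "inverse ?D" "H oo \<Phi>" "?D * H"]
    by (auto simp: AJ_def pullback_def D')
qed

lemma AJ_sols_eq_stabilizer:
  "AJ_sols s H = {\<Phi> \<in> carrier (subst_group s). pullback s H \<Phi> = fps_red s H}"
  using AJ_iff_pullback by (auto simp: AJ_sols_def carrier_subst_group_iff)

lemma subgroup_AJ_sols:
  assumes s: "1 \<le> s" and H: "H $ 0 = 0"
  shows "subgroup (AJ_sols s H) (subst_group s)"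
proof -
  interpret group "subst_group s :: 'a fps monoid"
    by (rule group_subst_group[OF s])
  have H0: "fps_red s H $ 0 = 0"
    using H by simp
  have red: "pullback s (fps_red s H) \<Phi> = pullback s H \<Phi>" for \<Phi>
    unfolding pullback_def by (intro fps_red_mult_cong fps_red_compose_cong) simp_all
  show ?thesis
  proof (rule subgroupI)
    show "AJ_sols s H \<subseteq> carrier (subst_group s)"
      by (auto simp: AJ_sols_def)
    have "fps_X \<in> AJ_sols s H"
      using one_closed by (simp add: AJ_sols_eq_stabilizer pullback_one subst_group_one)
    then show "AJ_sols s H \<noteq> {}"
      by blast
  next
    fix F assume "F \<in> AJ_sols s H"
    then have F: "F \<in> carrier (subst_group s)" "pullback s H F = fps_red s H"
      by (auto simp: AJ_sols_eq_stabilizer)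
    have "pullback s H (inv\<^bsub>subst_group s\<^esub> F) = pullback s (pullback s H F) (inv\<^bsub>subst_group s\<^esub> F)"
      using F(2) by (simp add: red)
    also have "\<dots> = pullback s H \<one>\<^bsub>subst_group s\<^esub>"
      using F(1) pullback_mult[OF s H F(1) inv_closed[OF F(1)]] by simp
    finally show "inv\<^bsub>subst_group s\<^esub> F \<in> AJ_sols s H"
      using F by (simp add: AJ_sols_eq_stabilizer subst_group_one pullback_one)
  next
    fix F E assume "F \<in> AJ_sols s H" "E \<in> AJ_sols s H"
    then show "F \<otimes>\<^bsub>subst_group s\<^esub> E \<in> AJ_sols s H"
      using s H by (auto simp: AJ_sols_eq_stabilizer pullback_mult red)
  qed
qed

text \<open>The stabilizers of two points of one orbit are conjugate.\<close>

lemma inner_aut_mem_AJ_sols_iff: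
  assumes s: "1 \<le> s" and H: "H $ 0 = 0" "H \<in> trunc_fps s"
    and T: "T \<in> carrier (subst_group s)" and F: "F \<in> carrier (subst_group s)"
  shows "inner_aut (subst_group s) T F \<in> AJ_sols s (pullback s H T) \<longleftrightarrow> F \<in> AJ_sols s H"
proof -
  let ?G = "subst_group s :: 'a fps monoid"
  interpret group ?G
    by (rule group_subst_group[OF s])
  have act: "pullback s (pullback s K A) B = pullback s K (A \<otimes>\<^bsub>?G\<^esub> B)"
    if "K $ 0 = 0" "A \<in> carrier ?G" "B \<in> carrier ?G" for K A B
    using pullback_mult[OF s that] ..
  have cancel: "pullback s H F = H" if "pullback s (pullback s H F) T = pullback s H T"
  proof -
    have "pullback s (pullback s (pullback s H F) T) (inv\<^bsub>?G\<^esub> T)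
        = pullback s (pullback s H T) (inv\<^bsub>?G\<^esub> T)"
      using that by simp
    then show ?thesis
      using T F H
      by (simp add: act m_assoc) (simp add: subst_group_one pullback_one fps_red_trunc)
  qed
  have "pullback s (pullback s H T) (inner_aut ?G T F)
      = pullback s H (T \<otimes>\<^bsub>?G\<^esub> inner_aut ?G T F)"
    using T F H by (simp add: act inner_aut_def)
  also have "T \<otimes>\<^bsub>?G\<^esub> inner_aut ?G T F = F \<otimes>\<^bsub>?G\<^esub> T"
    using T F by (simp add: inner_aut_def m_assoc[symmetric])
  also have "pullback s H (F \<otimes>\<^bsub>?G\<^esub> T) = pullback s (pullback s H F) T"
    using T F H by (simp add: act)
  finally have "pullback s (pullback s H T) (inner_aut ?G T F) = pullback s H T
      \<longleftrightarrow> pullback s H F = H"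
    using cancel by auto
  then show ?thesis
    using T F H
    by (simp add: AJ_sols_eq_stabilizer fps_red_trunc inner_aut_def) (simp add: pullback_def)
qed

lemma (in group) inner_aut_closed:
  "t \<in> carrier G \<Longrightarrow> f \<in> carrier G \<Longrightarrow> inner_aut G t f \<in> carrier G"
  by (simp add: inner_aut_def)

lemma (in group) inner_aut_inverse:
  "t \<in> carrier G \<Longrightarrow> f \<in> carrier G \<Longrightarrow> inner_aut G t (inner_aut G (inv t) f) = f"
  by (simp add: inner_aut_def m_assoc) (simp add: m_assoc[symmetric])

lemma inner_aut_image_AJ_sols:
  assumes s: "1 \<le> s" and H: "H $ 0 = 0" "H \<in> trunc_fps s" and T: "T \<in> carrier (subst_group s)"
  shows "inner_aut (subst_group s) T ` AJ_sols s H = AJ_sols s (pullback s H T)"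
    and "AJ_sols s H
      = inner_aut (subst_group s) (inv\<^bsub>subst_group s\<^esub> T) ` AJ_sols s (pullback s H T)"
proof -
  let ?G = "subst_group s :: 'a fps monoid"
  interpret group ?G
    by (rule group_subst_group[OF s])
  have sub: "AJ_sols s K \<subseteq> carrier ?G" for K :: "'a fps"
    by (auto simp: AJ_sols_def)
  have iff: "inner_aut ?G T F \<in> AJ_sols s (pullback s H T) \<longleftrightarrow> F \<in> AJ_sols s H"
    if "F \<in> carrier ?G" for F
    using inner_aut_mem_AJ_sols_iff[OF s H T that] .
  have inv1: "inner_aut ?G T (inner_aut ?G (inv\<^bsub>?G\<^esub> T) F) = F" if "F \<in> carrier ?G" for F
    using inner_aut_inverse[OF T that] .
  have inv2: "inner_aut ?G (inv\<^bsub>?G\<^esub> T) (inner_aut ?G T F) = F" if "F \<in> carrier ?G" for F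
    using inner_aut_inverse[of "inv\<^bsub>?G\<^esub> T" F] T that by simp
  have closed: "inner_aut ?G (inv\<^bsub>?G\<^esub> T) F \<in> carrier ?G" if "F \<in> carrier ?G" for F
    using inner_aut_closed[of "inv\<^bsub>?G\<^esub> T" F] T that by simp
  have conj_mem: "inner_aut ?G (inv\<^bsub>?G\<^esub> T) F \<in> AJ_sols s H"
    if "F \<in> AJ_sols s (pullback s H T)" for F
    using iff[OF closed] inv1 that sub[THEN subsetD, OF that] by simp
  show "inner_aut ?G T ` AJ_sols s H = AJ_sols s (pullback s H T)"
  proof (intro equalityI subsetI)
    fix F assume F: "F \<in> AJ_sols s (pullback s H T)"
    show "F \<in> inner_aut ?G T ` AJ_sols s H"
      using inv1[OF subsetD[OF sub F]] conj_mem[OF F] by (metis imageI)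
  qed (use iff sub in blast)
  show "AJ_sols s H = inner_aut ?G (inv\<^bsub>?G\<^esub> T) ` AJ_sols s (pullback s H T)"
  proof (intro equalityI subsetI)
    fix F assume F: "F \<in> AJ_sols s H"
    show "F \<in> inner_aut ?G (inv\<^bsub>?G\<^esub> T) ` AJ_sols s (pullback s H T)"
      using inv2[OF subsetD[OF sub F]] iff[OF subsetD[OF sub F]] F by (metis imageI)
  qed (use conj_mem in blast)
qed

section \<open>Splitting off the linear substitutions\<close>

text \<open>
  If \<open>h\<close> is the leading coefficient of \<open>H\<close> and \<open>c\<close> the linear coefficient of \<open>\<Phi>\<close>, comparison
  at \<open>x ^ (l + 1)\<close> reads \<open>h * c ^ (l + 1) = c * h\<close>.
\<close>

lemma AJ_sols_nth_1:
  assumes "enat (l + 1) \<le> s" and low: "\<And>i. i \<le> l \<Longrightarrow> H $ i = 0" and lead: "H $ (l + 1) \<noteq> 0"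
    and "\<Phi> \<in> AJ_sols s H"
  shows "\<Phi> $ 1 \<in> roots_of_1 l"
proof -
  have \<Phi>: "\<Phi> $ 0 = 0" "\<Phi> $ 1 \<noteq> 0" and "AJ s H \<Phi>"
    using assms(4) by (auto simp: AJ_sols_def carrier_subst_group_iff)
  then have eq: "(H oo \<Phi>) $ (l + 1) = (fps_deriv \<Phi> * H) $ (l + 1)"
    using assms(1) unfolding AJ_def fps_red_eq_iff by blast
  have "(H oo \<Phi>) $ (l + 1) = (\<Sum>i = 0..l + 1. if i = l + 1 then H $ i * (\<Phi> $ 1) ^ i else 0)"
    unfolding fps_compose_nth
  proof (intro sum.cong refl)
    fix i assume i: "i \<in> {0..l + 1}"
    show "H $ i * \<Phi> ^ i $ (l + 1) = (if i = l + 1 then H $ i * (\<Phi> $ 1) ^ i else 0)"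
    proof (cases "i = l + 1")
      case True
      show ?thesis
        unfolding True startsby_zero_power_nth_same[OF \<Phi>(1)] by simp
    next
      case False
      then show ?thesis
        using i low[of i] by simp
    qed
  qed
  moreover have "(fps_deriv \<Phi> * H) $ (l + 1)
      = (\<Sum>i = 0..l + 1. if i = 0 then \<Phi> $ 1 * H $ (l + 1) else 0)"
    unfolding fps_mult_nth by (intro sum.cong) (auto simp: low)
  ultimately have "H $ (l + 1) * (\<Phi> $ 1) ^ (l + 1) = \<Phi> $ 1 * H $ (l + 1)"
    using eq by simp
  then show ?thesis
    using lead \<Phi>(2) by (simp add: roots_of_1_def)
qed

lemma lin_fps_nth [simp]: "lin_fps c $ n = (if n = 1 then c else 0)"
  by (auto simp: lin_fps_def)

lemma lin_fps_one: "lin_fps 1 = fps_X"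
  by (simp add: lin_fps_def)

lemma lin_fps_in_carrier: "1 \<le> s \<Longrightarrow> c \<noteq> 0 \<Longrightarrow> lin_fps c \<in> carrier (subst_group s)"
  using one_enat_def by (auto simp: carrier_subst_group_iff trunc_fps_def)

lemma lin_fps_mult:
  assumes "1 \<le> s" and "c \<noteq> 0" and "d \<noteq> 0"
  shows "lin_fps c \<otimes>\<^bsub>subst_group s\<^esub> lin_fps d = lin_fps (c * d)"
proof -
  have "lin_fps c oo lin_fps d = lin_fps (c * d)"
    by (simp add: lin_fps_def[of d] fps_compose_linear fps_eq_iff)
  then show ?thesis
    using lin_fps_in_carrier[of s "c * d"] assms
    by (simp add: subst_group_mult fps_red_trunc carrier_subst_group_iff)
qed

lemma roots_of_1_nonzero: "1 \<le> l \<Longrightarrow> c \<in> roots_of_1 l \<Longrightarrow> c \<noteq> 0"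
  by (auto simp: roots_of_1_def power_0_left)

lemma subgroup_lin_group:
  assumes s: "1 \<le> s" and l: "1 \<le> l"
  shows "subgroup (lin_group l) (subst_group s)"
proof -
  interpret group "subst_group s :: 'a fps monoid"
    by (rule group_subst_group[OF s])
  show ?thesis
  proof (rule subgroupI)
    show "lin_group l \<subseteq> carrier (subst_group s)"
      using roots_of_1_nonzero[OF l] lin_fps_in_carrier[OF s] by (auto simp: lin_group_def)
    show "lin_group l \<noteq> {}"
      by (auto simp: lin_group_def roots_of_1_def intro: exI[of _ 1])
  next
    fix F :: "'a fps" assume "F \<in> lin_group l"
    then obtain c where c: "c \<in> roots_of_1 l" "F = lin_fps c"
      by (auto simp: lin_group_def)
    have c0: "c \<noteq> 0"
      using roots_of_1_nonzero[OF l c(1)] .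
    have "lin_fps (inverse c) \<otimes>\<^bsub>subst_group s\<^esub> F = \<one>\<^bsub>subst_group s\<^esub>"
      using c c0 s by (simp add: lin_fps_mult subst_group_one lin_fps_one)
    then have "inv\<^bsub>subst_group s\<^esub> F = lin_fps (inverse c)"
      using c c0 s by (intro inv_equality) (auto intro: lin_fps_in_carrier)
    then show "inv\<^bsub>subst_group s\<^esub> F \<in> lin_group l"
      using c by (auto simp: lin_group_def roots_of_1_def power_inverse)
  next
    fix F E :: "'a fps" assume "F \<in> lin_group l" "E \<in> lin_group l"
    then obtain c d where cd: "c \<in> roots_of_1 l" "F = lin_fps c" "d \<in> roots_of_1 l" "E = lin_fps d"
      by (auto simp: lin_group_def)
    then have "F \<otimes>\<^bsub>subst_group s\<^esub> E = lin_fps (c * d)"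
      using s roots_of_1_nonzero[OF l cd(1)] roots_of_1_nonzero[OF l cd(3)]
      by (simp add: lin_fps_mult)
    moreover have "c * d \<in> roots_of_1 l"
      using cd by (simp add: roots_of_1_def power_mult_distrib)
    ultimately show "F \<otimes>\<^bsub>subst_group s\<^esub> E \<in> lin_group l"
      by (auto simp: lin_group_def)
  qed
qed

text \<open>
  Taking the linear coefficient is a homomorphism on any group \<open>S\<close> of substitutions. If its
  values on \<open>S\<close> are \<open>l\<close>-th roots of unity and \<open>S\<close> contains all \<open>L\<^sub>c\<close> with \<open>c ^ l = 1\<close>, then
  \<open>c \<mapsto> L\<^sub>c\<close> splits it, and its kernel consists of the elements tangent to the identity.
\<close>

lemma internal_semidirect_lin_group:
  assumes s: "1 \<le> s" and l: "1 \<le> l" and S: "subgroup S (subst_group s)"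
    and lin: "lin_group l \<subseteq> S" and roots: "\<And>\<Phi>. \<Phi> \<in> S \<Longrightarrow> \<Phi> $ 1 \<in> roots_of_1 l"
  shows "internal_semidirect (subst_group s\<lparr>carrier := S\<rparr>) (lin_group l) (S \<inter> subst_group1 s)"
proof -
  let ?G = "subst_group s :: 'a fps monoid" and ?N = "S \<inter> subst_group1 s"
  interpret group ?G
    by (rule group_subst_group[OF s])
  interpret S: group "?G\<lparr>carrier := S\<rparr>"
    by (rule subgroup_imp_group[OF S])
  have SG: "\<Phi> \<in> carrier ?G" if "\<Phi> \<in> S" for \<Phi>
    using subgroup.mem_carrier[OF S that] .
  have N: "?N = {\<Phi> \<in> S. \<Phi> $ 1 = 1}"
    using SG by (auto simp: subst_group1_def)
  have nth_1: "(F \<otimes>\<^bsub>?G\<^esub> E) $ 1 = F $ 1 * E $ 1" if "E \<in> carrier ?G" for F E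
    using subst_group_mult_nth_1[OF s that] .
  have inv_nth_1: "(inv\<^bsub>?G\<^esub> F) $ 1 * F $ 1 = 1" if "F \<in> carrier ?G" for F
    using nth_1[OF that, of "inv\<^bsub>?G\<^esub> F"] that by (simp add: subst_group_one)
  have closed: "F \<otimes>\<^bsub>?G\<^esub> E \<in> S" "inv\<^bsub>?G\<^esub> F \<in> S" if "F \<in> S" "E \<in> S" for F E
    using S that by (auto simp: subgroup.m_closed subgroup.m_inv_closed)
  have subN: "subgroup ?N ?G"
  proof (rule subgroupI)
    show "?N \<noteq> {}"
      unfolding N using subgroup.one_closed[OF S] by (auto simp: subst_group_one)
    show "inv\<^bsub>?G\<^esub> F \<in> ?N" if "F \<in> ?N" for F
      using that closed(2)[of F F] inv_nth_1[of F] SG[of F] unfolding N by simp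
    show "F \<otimes>\<^bsub>?G\<^esub> E \<in> ?N" if "F \<in> ?N" "E \<in> ?N" for F E
      using that closed(1)[of F E] nth_1[of E F] SG[of E] unfolding N by simp
  qed (use SG in auto)
  have "?N \<lhd> ?G\<lparr>carrier := S\<rparr>"
    unfolding S.normal_inv_iff
  proof (intro conjI ballI)
    show "subgroup ?N (?G\<lparr>carrier := S\<rparr>)"
      by (rule subgroup_incl[OF subN S]) simp
    fix F E assume F: "F \<in> carrier (?G\<lparr>carrier := S\<rparr>)" and E: "E \<in> ?N"
    have "(F \<otimes>\<^bsub>?G\<^esub> E \<otimes>\<^bsub>?G\<^esub> inv\<^bsub>?G\<^esub> F) $ 1 = (inv\<^bsub>?G\<^esub> F) $ 1 * F $ 1"
      using F E nth_1[OF SG, of E F] nth_1[OF inv_closed[OF SG], of F "F \<otimes>\<^bsub>?G\<^esub> E"]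
      unfolding N by simp
    then have "F \<otimes>\<^bsub>?G\<^esub> E \<otimes>\<^bsub>?G\<^esub> inv\<^bsub>?G\<^esub> F \<in> ?N"
      using F E closed inv_nth_1[OF SG, of F] unfolding N by simp
    then show "F \<otimes>\<^bsub>?G\<lparr>carrier := S\<rparr>\<^esub> E \<otimes>\<^bsub>?G\<lparr>carrier := S\<rparr>\<^esub>
        inv\<^bsub>?G\<lparr>carrier := S\<rparr>\<^esub> F \<in> ?N"
      using F S by simp
  qed
  moreover have "S = lin_group l <#>\<^bsub>?G\<lparr>carrier := S\<rparr>\<^esub> ?N"
  proof
    show "lin_group l <#>\<^bsub>?G\<lparr>carrier := S\<rparr>\<^esub> ?N \<subseteq> S"
      using lin closed by (auto simp: set_mult_def)
    show "S \<subseteq> lin_group l <#>\<^bsub>?G\<lparr>carrier := S\<rparr>\<^esub> ?N"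
    proof
      fix F assume F: "F \<in> S"
      define L where "L = lin_fps (F $ 1)"
      have L: "L \<in> lin_group l"
        using roots[OF F] by (simp add: L_def lin_group_def)
      then have LS: "L \<in> S"
        using lin by blast
      have "(inv\<^bsub>?G\<^esub> L) $ 1 * F $ 1 = 1"
        using inv_nth_1[of L] SG[OF LS] by (simp add: L_def)
      then have "inv\<^bsub>?G\<^esub> L \<otimes>\<^bsub>?G\<^esub> F \<in> ?N"
        unfolding N using F LS closed nth_1[OF SG[OF F]] by simp
      moreover have "F = L \<otimes>\<^bsub>?G\<^esub> (inv\<^bsub>?G\<^esub> L \<otimes>\<^bsub>?G\<^esub> F)"
        using SG[OF F] SG[OF LS] by (simp add: m_assoc[symmetric])
      ultimately show "F \<in> lin_group l <#>\<^bsub>?G\<lparr>carrier := S\<rparr>\<^esub> ?N"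
        using L by (auto simp: set_mult_def)
    qed
  qed
  moreover have "lin_group l \<inter> ?N = {fps_X}"
  proof
    show "lin_group l \<inter> ?N \<subseteq> {fps_X}"
      by (auto simp: lin_group_def subst_group1_def lin_fps_one)
    show "{fps_X} \<subseteq> lin_group l \<inter> ?N"
      using subgroup.one_closed[OF subN] subgroup.one_closed[OF subgroup_lin_group[OF s l]]
      by (simp add: subst_group_one)
  qed
  ultimately show ?thesis
    using S.group_axioms subgroup_incl[OF subgroup_lin_group[OF s l] S lin]
    by (simp add: internal_semidirect_def subst_group_one)
qed

lemma normal_form_nth:
  fixes \<delta> :: "'a::comm_ring_1"
  shows "(fps_X ^ (l + 1) + fps_const \<delta> * fps_X ^ (2 * l + 1)) $ n
    = (if n = l + 1 then 1 else 0) + (if n = 2 * l + 1 then \<delta> else 0)"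
  by (simp only: fps_add_nth fps_mult_left_const_nth fps_X_power_nth) simp

text \<open>
  The exponents of \<open>x ^ (l + 1) + \<delta> * x ^ (2 * l + 1)\<close> are congruent to \<open>1\<close> modulo \<open>l\<close>, so
  scaling \<open>x\<close> by an \<open>l\<close>-th root of unity \<open>c\<close> multiplies the series by \<open>c\<close>, which is
  also the derivative of \<open>L\<^sub>c\<close>.
\<close>

lemma lin_group_subset_AJ_sols:
  assumes s: "1 \<le> s" and l: "1 \<le> l"
  shows "lin_group l
    \<subseteq> AJ_sols s (fps_X ^ (l + 1) + fps_const \<delta> * fps_X ^ (2 * l + 1))" (is "_ \<subseteq> AJ_sols s ?H")
proof
  fix F :: "'a fps" assume "F \<in> lin_group l"
  then obtain c where c: "c ^ l = 1" "F = lin_fps c" and "c \<noteq> 0"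
    using roots_of_1_nonzero[OF l] by (auto simp: lin_group_def roots_of_1_def)
  have "c ^ n * ?H $ n = c * ?H $ n" for n
    unfolding normal_form_nth using c(1) by (auto simp: power_add mult_2)
  moreover have "fps_deriv F = fps_const c"
    by (simp add: c(2) lin_fps_def)
  ultimately have "?H oo F = fps_deriv F * ?H"
    unfolding c(2) lin_fps_def fps_compose_linear by (simp add: fps_eq_iff)
  then show "F \<in> AJ_sols s ?H"
    using lin_fps_in_carrier[OF s \<open>c \<noteq> 0\<close>] c(2) by (simp add: AJ_sols_def AJ_def)
qed

section \<open>The structure theorem\<close>

theorem theorem2:
  fixes s :: enat and l :: nat
    and H H' T :: "'a::field_char_0 fps" and \<delta> :: 'a
  assumes "1 \<le> l" and "enat (l + 1) \<le> s"
    and "H \<in> trunc_fps s" and "\<forall>i \<le> l. H $ i = 0" and "H $ (l + 1) = 1"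
    and "H' = fps_X ^ (l + 1) + fps_const \<delta> * fps_X ^ (2 * l + 1)"
    and "s \<le> enat (2 * l) \<longrightarrow> \<delta> = 0"
    and "AJ_transforms s T H H'"
  defines "G \<equiv> subst_group s :: 'a fps monoid"
  shows
    "(inner_aut G T ` AJ_sols s H = AJ_sols s H' \<and>
      internal_semidirect (G\<lparr>carrier := AJ_sols s H'\<rparr>) (lin_group l) (AJ_sols1 s H')) \<and>
     (AJ_sols s H = inner_aut G (inv\<^bsub>G\<^esub> T) ` AJ_sols s H' \<and>
      AJ_sols s H = {T \<otimes>\<^bsub>G\<^esub> (lin_fps c \<otimes>\<^bsub>G\<^esub> \<Phi>) \<otimes>\<^bsub>G\<^esub> inv\<^bsub>G\<^esub> T | c \<Phi>.
                       c \<in> roots_of_1 l \<and> \<Phi> \<in> AJ_sols1 s H'})"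
proof -
  have s: "1 \<le> s"
    using assms(2) by (rule order.trans[rotated]) (simp add: one_enat_def)
  interpret group G
    unfolding G_def by (rule group_subst_group[OF s])
  have T: "T \<in> carrier G" and H': "H' = pullback s H T"
    using assms(8) by (auto simp: AJ_transforms_def subst_group1_def pullback_def G_def)
  have H0: "H $ 0 = 0"
    using assms(4) by simp
  have H'0: "H' $ 0 = 0"
    using pullback_nth_0[OF H0] H' by simp
  have image: "inner_aut G T ` AJ_sols s H = AJ_sols s H'"
    "AJ_sols s H = inner_aut G (inv\<^bsub>G\<^esub> T) ` AJ_sols s H'"
    using inner_aut_image_AJ_sols[OF s H0 assms(3) T[unfolded G_def]] unfolding G_def H' by blast+
  have "H' $ i = 0" if "i \<le> l" for i
    using that assms(1) unfolding assms(6) normal_form_nth by simp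
  moreover have "H' $ (l + 1) \<noteq> 0"
    using assms(1) unfolding assms(6) normal_form_nth by simp
  ultimately have roots: "\<Phi> $ 1 \<in> roots_of_1 l" if "\<Phi> \<in> AJ_sols s H'" for \<Phi>
    using AJ_sols_nth_1[OF assms(2) _ _ that] by blast
  have semi: "internal_semidirect (G\<lparr>carrier := AJ_sols s H'\<rparr>) (lin_group l) (AJ_sols1 s H')"
    unfolding G_def AJ_sols1_def
    using lin_group_subset_AJ_sols[OF s assms(1)] roots
    by (intro internal_semidirect_lin_group[OF s assms(1) subgroup_AJ_sols[OF s H'0]])
      (simp_all add: assms(6))
  then have "AJ_sols s H' = {lin_fps c \<otimes>\<^bsub>G\<^esub> \<Phi> | c \<Phi>. c \<in> roots_of_1 l \<and> \<Phi> \<in> AJ_sols1 s H'}"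
    by (auto simp: internal_semidirect_def set_mult_def lin_group_def)
  moreover have "inner_aut G (inv\<^bsub>G\<^esub> T) F = T \<otimes>\<^bsub>G\<^esub> F \<otimes>\<^bsub>G\<^esub> inv\<^bsub>G\<^esub> T" for F
    using T by (simp add: inner_aut_def)
  ultimately have "AJ_sols s H = {T \<otimes>\<^bsub>G\<^esub> (lin_fps c \<otimes>\<^bsub>G\<^esub> \<Phi>) \<otimes>\<^bsub>G\<^esub> inv\<^bsub>G\<^esub> T | c \<Phi>.
      c \<in> roots_of_1 l \<and> \<Phi> \<in> AJ_sols1 s H'}"
    using image(2) by auto
  with image semi show ?thesis
    by blast
qed

end
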